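(* Let $H$ and $G$ be separable Hilbert spaces, let $Q\in L(H)$ be a nonnegative self-adjoint nuclear operator, and let $A\in L(G,H)$ be an injective bounded linear operator. Set $U:=\operatorname{ran}(A)$ and assume that $U$ and $U^\perp$ are $Q$-invariant. Fix a known $\sigma^2\in(0,\infty)$ and consider the statistical model on $H$ with probability measures $\mathrm{N}(A\beta,\sigma^2Q)$, $\beta\in G$, with observation $Y$. Let $\widehat{\beta}(Y):=A^{-1}\Pi_UY$ be the least square estimator for $\beta$. Let $c\in G$ with $\langle Q(A^{-1})^*c,\Pi_U(A^{-1})^*c\rangle>0$ and $\alpha\in(0,1)$ be arbitrary. Then the random interval $$\langle c,\widehat{\beta}(Y)\rangle\pm z_{1-\frac{\alpha}{2}}\,\sigma\sqrt{\langle Q(A^{-1})^*c,\Pi_U(A^{-1})^*c\rangle}$$ is a $(1-\alpha)$-confidence interval for $\langle c,\beta\rangle$.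
   Context: A subspace $V\subset H$ is $Q$-invariant if $Q(V)\subset V$. In the source it is asserted that, due to the open mapping theorem, the injective operator $A$ is an isomorphism $A\in L(G,U)$ and hence $U$ is a closed subspace of $H$; $A^{-1}:U\to G$ denotes its inverse, $(A^{-1})^*:G\to U$ the adjoint of $A^{-1}$, and $\Pi_U$ the orthogonal projection onto $U$. $\mathrm{N}(\xi,\sigma^2Q)$ is the Gaussian measure on $H$ with mean $\xi$ and covariance operator $\sigma^2Q$, i.e. if $Y$ has this law then $\langle b,Y\rangle\sim\mathrm{N}(\langle b,\xi\rangle,\sigma^2\langle Qb,b\rangle)$ (possibly degenerate) for all $b\in H$. $Y$ is the $H$-valued observation (the identity map on $H$). For $a\in(0,1)$, $z_a$ is the $a$-quantile of the standard normal distribution $\mathrm{N}(0,1)$. The notation $x\pm r$ means the interval $[x-r,x+r]$. A random interval $I(Y)$ is a $(1-\alpha)$-confidence interval for $\langle c,\beta\rangle$ if, for every $\beta\in G$, when $Y\sim\mathrm{N}(A\beta,\sigma^2Q)$ the probability that $\langle c,\beta\rangle\in I(Y)$ is at least $1-\alpha$.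
   Formalization: The range U of A is assumed closed; injectivity of a bounded A does not imply this in infinite dimensions (e.g. A = diag(1/n) on ℓ²), and without it the projection Π_U and the estimator are undefined. *)

theory Defs
  imports "HOL-Probability.Probability"
begin

text \<open>
  Separable real Hilbert spaces are types of sort \<open>{real_inner, polish_space}\<close>, i.e. complete
  inner product spaces with a countable base (for metric spaces the same as separability).
\<close>

text \<open>Functionals are represented by vectors (Riesz), so this is
  \<open>T = (\<Sum>n. \<langle>a n, \<cdot>\<rangle> b n)\<close> with \<open>(\<Sum>n. \<parallel>a n\<parallel> \<parallel>b n\<parallel>) < \<infinity>\<close>.\<close>

definition nuclear_operator :: "('a::real_inner \<Rightarrow> 'b::real_inner) \<Rightarrow> bool" where
  "nuclear_operator T \<longleftrightarrow>
     (\<exists>a b. summable (\<lambda>n::nat. norm (a n) * norm (b n)) \<and>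
            (\<forall>x. (\<lambda>n. (a n \<bullet> x) *\<^sub>R b n) sums T x))"

text \<open>\<open>orth_proj\<close> and \<open>adjoint_on\<close> are meaningful only if \<open>U\<close> is a closed subspace (and, for
  \<open>adjoint_on\<close>, if \<open>T\<close> is linear and bounded on \<open>U\<close>); the description is unspecified otherwise.
  The library's \<open>closest_point\<close> and \<open>adjoint\<close> do not apply here: the former is restricted to
  Heine-Borel spaces, the latter to operators defined on a whole type. The adjoint of
  \<open>T : U \<rightarrow> G\<close> takes its values in \<open>U\<close>.\<close>

definition orth_proj :: "'a::real_inner set \<Rightarrow> 'a \<Rightarrow> 'a" where
  "orth_proj U x = (THE u. u \<in> U \<and> x - u \<in> U\<^sup>\<bottom>)"

definition adjoint_on :: "'a::real_inner set \<Rightarrow> ('a \<Rightarrow> 'b::real_inner) \<Rightarrow> 'b \<Rightarrow> 'a" where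
  "adjoint_on U T c = (THE u. u \<in> U \<and> (\<forall>v\<in>U. T v \<bullet> c = v \<bullet> u))"

definition normal_law :: "real \<Rightarrow> real \<Rightarrow> real measure" where
  "normal_law m v =
     (if v = 0 then return borel m else density lborel (normal_density m (sqrt v)))"

text \<open>\<open>M\<close> is the law \<open>N(\<xi>, C)\<close>. Note that the second argument of \<^const>\<open>normal_law\<close> is the
  variance, whereas \<^const>\<open>normal_density\<close> takes the standard deviation.\<close>

definition gaussian_measure ::
    "'a::real_inner measure \<Rightarrow> 'a \<Rightarrow> ('a \<Rightarrow> 'a) \<Rightarrow> bool" where
  "gaussian_measure M \<xi> C \<longleftrightarrow>
     prob_space M \<and> sets M = sets borel \<and>
     (\<forall>b. distr M borel (\<lambda>y. b \<bullet> y) = normal_law (b \<bullet> \<xi>) (C b \<bullet> b))"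

definition quantile :: "real measure \<Rightarrow> real \<Rightarrow> real" where
  "quantile M a = Inf {x. a \<le> cdf M x}"

text \<open>\<open>P\<close> is the statistical model (the observation being the identity on the sample space),
  \<open>\<tau>\<close> the quantity of interest and \<open>I\<close> the random interval. The event has to be measurable,
  since \<^const>\<open>measure\<close> has no probabilistic meaning on other sets.\<close>

definition confidence_interval ::
    "('p \<Rightarrow> 'a measure) \<Rightarrow> ('p \<Rightarrow> real) \<Rightarrow> ('a \<Rightarrow> real set) \<Rightarrow> real \<Rightarrow> bool" where
  "confidence_interval P \<tau> I \<gamma> \<longleftrightarrow>
     (\<forall>\<theta>. {y \<in> space (P \<theta>). \<tau> \<theta> \<in> I y} \<in> sets (P \<theta>) \<and>
          \<gamma> \<le> measure (P \<theta>) {y \<in> space (P \<theta>). \<tau> \<theta> \<in> I y})"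

definition least_square_estimator ::
    "('g::real_inner \<Rightarrow> 'h::real_inner) \<Rightarrow> 'h \<Rightarrow> 'g" where
  "least_square_estimator A y = inv_into UNIV A (orth_proj (range A) y)"

end

theory Submission
  imports Defs
begin

text \<open>
  Everything rests on one identity: the estimator \<open>\<langle>c, A\<^sup>-\<^sup>1 \<Pi>\<^sub>U y\<rangle>\<close> is the inner product of the
  observation \<open>y\<close> with the single vector \<open>w = (A\<^sup>-\<^sup>1)\<^sup>* c\<close> of \<open>U\<close>, because
  \<open>\<langle>c, A\<^sup>-\<^sup>1 \<Pi>\<^sub>U y\<rangle> = \<langle>w, \<Pi>\<^sub>U y\<rangle> = \<langle>w, y\<rangle>\<close> (\<open>inner_least_square_estimator\<close>). By the definition of a
  Gaussian measure on \<open>H\<close> it therefore has a one-dimensional normal law. Its mean is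
  \<open>\<langle>w, A \<beta>\<rangle> = \<langle>c, \<beta>\<rangle>\<close> and its variance is \<open>\<sigma>\<^sup>2 \<langle>Q w, w\<rangle> = \<sigma>\<^sup>2 \<langle>Q w, \<Pi>\<^sub>U w\<rangle>\<close>, since \<open>\<Pi>\<^sub>U w = w\<close>.
  The half-width of the interval is the \<open>(1 - \<alpha>/2)\<close>-quantile times the standard deviation of this
  law, so the coverage probability is at least \<open>1 - \<alpha>\<close> by the symmetry of the standard normal
  distribution (\<open>normal_law_quantile_interval\<close>).

  The analytic content lies in the existence of \<open>w\<close> and of \<open>\<Pi>\<^sub>U\<close>. Both are representing vectors of
  functionals on the closed subspace \<open>U\<close> (\<open>Riesz_closed_subspace\<close>): \<open>\<Pi>\<^sub>U y\<close> represents
  \<open>v \<mapsto> \<langle>y, v\<rangle>\<close>, and \<open>w\<close> represents \<open>v \<mapsto> \<langle>A\<^sup>-\<^sup>1 v, c\<rangle>\<close>. The latter functional is bounded because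
  \<open>A\<close>, having closed range, is open onto it (\<open>bounded_preimage\<close>).
\<close>

section \<open>The open mapping theorem for an operator with closed range\<close>

text \<open>The closures of the images of the balls of integer radius are countably many closed sets that
  cover the complete space \<open>range A\<close>, so by Baire the one for some radius \<open>n\<close> contains a ball
  of \<open>range A\<close>. Subtracting the centre moves that ball to the origin, at the price that its points
  are now approximated by images of vectors of norm at most \<open>2 n\<close>; homogeneity does the rest.\<close>

lemma approximate_preimage:
  fixes A :: "'a::real_normed_vector \<Rightarrow> 'b::{real_normed_vector, complete_space}"
  assumes "bounded_linear A" and "closed (range A)"
  obtains M where "0 < M"
    and "\<And>v. v \<in> range A \<Longrightarrow> \<exists>x. norm x \<le> M * norm v \<and> norm (v - A x) \<le> norm v / 2"
proof -
  interpret A: bounded_linear A by fact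
  define X where "X = top_of_set (range A)"
  define B where "B n = closure (A ` cball 0 (real n))" for n
  have sub: "B n \<subseteq> range A" for n
    unfolding B_def using assms(2) by (intro closure_minimal) auto
  have cover: "(\<Union>n. B n) = range A"
  proof (intro antisym subsetI)
    fix v assume "v \<in> range A"
    then obtain x where x: "v = A x" by auto
    obtain n where "norm x \<le> real n" using real_arch_simple by blast
    then have "v \<in> B n"
      unfolding B_def x by (intro subsetD[OF closure_subset]) auto
    then show "v \<in> (\<Union>n. B n)" by auto
  qed (use sub in auto)
  have "\<exists>n. X interior_of (B n) \<noteq> {}"
  proof (rule ccontr)
    assume "\<not> ?thesis"
    then have "X interior_of \<Union>(range B) = {}"
      unfolding X_def
      by (intro Baire_category_alt disjI1 completely_metrizable_space_closedin
            completely_metrizable_space_euclidean)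
         (use assms(2) sub in \<open>auto simp: B_def closed_subset\<close>)
    moreover have "X interior_of topspace X = topspace X" by (rule interior_of_topspace)
    ultimately show False
      using cover by (simp add: X_def)
  qed
  then obtain n u where "u \<in> X interior_of (B n)" by auto
  then obtain T where T: "open T" "u \<in> T" "range A \<inter> T \<subseteq> B n" and u: "u \<in> range A"
    by (auto simp: X_def interior_of_def openin_open)
  then obtain r where r: "0 < r" "cball u r \<subseteq> T"
    using open_contains_cball by blast
  have near: "\<exists>x. norm x \<le> real n \<and> norm (v - A x) < e" if "v \<in> B n" "0 < e" for v e
    using that by (force simp: B_def closure_approachable dist_norm norm_minus_commute)
  have small: "\<exists>x. norm x \<le> 2 * real n \<and> norm (v - A x) \<le> e"
    if v: "v \<in> range A" "norm v \<le> r" and e: "0 < e" for v e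
  proof -
    have "u + v \<in> range A"
      using u v by (auto simp flip: A.add)
    moreover have "u + v \<in> cball u r" using v by (simp add: dist_norm)
    ultimately have "u + v \<in> B n" using r T by blast
    then obtain x where x: "norm x \<le> real n" "norm (u + v - A x) < e / 2"
      using near e by (metis half_gt_zero)
    have "u \<in> B n" using T u by blast
    then obtain y where y: "norm y \<le> real n" "norm (u - A y) < e / 2"
      using near e by (metis half_gt_zero)
    have "norm (x - y) \<le> 2 * real n"
      using x y norm_triangle_ineq4[of x y] by simp
    moreover have "norm (v - A (x - y)) \<le> e"
      using norm_triangle_ineq4[of "u + v - A x" "u - A y"] x y by (simp add: A.diff algebra_simps)
    ultimately show ?thesis by blast
  qed
  show ?thesis
  proof
    show "0 < (2 * real n + 1) / r" using r by simp
    fix v assume v: "v \<in> range A"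
    show "\<exists>x. norm x \<le> (2 * real n + 1) / r * norm v \<and> norm (v - A x) \<le> norm v / 2"
    proof (cases "v = 0")
      case True
      then show ?thesis by (intro exI[of _ 0]) (simp add: A.zero)
    next
      case False
      define t where "t = r / norm v"
      have t: "0 < t" using False r by (simp add: t_def)
      have "t *\<^sub>R v \<in> range A" using v by (auto simp flip: A.scaleR)
      moreover have "norm (t *\<^sub>R v) \<le> r" using False r by (simp add: t_def)
      ultimately obtain x where x: "norm x \<le> 2 * real n" "norm (t *\<^sub>R v - A x) \<le> r / 2"
        using small[of "t *\<^sub>R v" "r / 2"] r by auto
      have "norm (v - A (x /\<^sub>R t)) = norm ((t *\<^sub>R v - A x) /\<^sub>R t)"
        using t by (simp add: A.scaleR algebra_simps)
      also have "\<dots> = norm (t *\<^sub>R v - A x) / t"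
        using t by (simp add: divide_inverse_commute)
      also have "\<dots> \<le> (r / 2) / t" using t x by (intro divide_right_mono) auto
      also have "\<dots> = norm v / 2" using r False by (simp add: t_def)
      finally have "norm (v - A (x /\<^sub>R t)) \<le> norm v / 2" .
      moreover have "norm (x /\<^sub>R t) \<le> (2 * real n + 1) / r * norm v"
      proof -
        have "norm (x /\<^sub>R t) = norm x / t" using t by (simp add: divide_inverse_commute)
        also have "\<dots> \<le> (2 * real n + 1) / t" using t x by (intro divide_right_mono) auto
        finally show ?thesis by (simp add: t_def)
      qed
      ultimately show ?thesis by blast
    qed
  qed
qed

text \<open>Solving \<open>A x = v\<close> approximately halves the residual, so solving again for the residual and
  summing the corrections gives a geometric series whose limit is an exact solution. This is where
  the completeness of the domain enters.\<close>

lemma bounded_preimage: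
  fixes A :: "'a::{real_normed_vector, complete_space} \<Rightarrow> 'b::{real_normed_vector, complete_space}"
  assumes "bounded_linear A" and "closed (range A)"
  obtains K where "\<And>v. v \<in> range A \<Longrightarrow> \<exists>x. A x = v \<and> norm x \<le> K * norm v"
proof -
  interpret A: bounded_linear A by fact
  obtain M where M: "0 < M"
    and "\<And>v. v \<in> range A \<Longrightarrow> \<exists>x. norm x \<le> M * norm v \<and> norm (v - A x) \<le> norm v / 2"
    using approximate_preimage[OF assms] by blast
  then obtain h where h: "\<And>v. v \<in> range A \<Longrightarrow> norm (h v) \<le> M * norm v"
    and h': "\<And>v. v \<in> range A \<Longrightarrow> norm (v - A (h v)) \<le> norm v / 2"
    by metis
  have "\<exists>x. A x = v \<and> norm x \<le> 2 * M * norm v" if v: "v \<in> range A" for v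
  proof -
    \<comment> \<open>\<open>R n\<close> is the residual after \<open>n\<close> corrections, \<open>s n\<close> the approximate solution reached by then.\<close>
    define R where "R n = ((\<lambda>u. u - A (h u)) ^^ n) v" for n
    define s where "s n = (\<Sum>k<n. h (R k))" for n
    have R_Suc: "R (Suc n) = R n - A (h (R n))" for n by (simp add: R_def)
    have R_range: "R n \<in> range A" for n
    proof (induction n)
      case 0 show ?case using v by (simp add: R_def)
    next
      case (Suc n)
      then obtain a where "R n = A a" by auto
      then have "R (Suc n) = A (a - h (R n))" by (simp add: R_Suc A.diff)
      then show ?case by simp
    qed
    have R_norm: "norm (R n) \<le> norm v / 2 ^ n" for n
    proof (induction n)
      case 0 show ?case by (simp add: R_def)
    next
      case (Suc n)
      then show ?case using h'[OF R_range[of n]] by (simp add: R_Suc)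
    qed
    have A_s: "A (s n) = v - R n" for n
      by (induction n) (simp_all add: s_def R_def A.zero A.add)
    have step: "norm (h (R n)) \<le> M * norm v / 2 ^ n" for n
      using h[OF R_range[of n]] mult_left_mono[OF R_norm[of n], of M] M by simp
    \<comment> \<open>The exact geometric sum is kept on the right, since the induction on \<open>k\<close> would not close with
      the bound \<open>2 * M * norm v / 2 ^ n\<close> alone.\<close>
    have dist: "norm (s (n + k) - s n) \<le> 2 * M * norm v / 2 ^ n - 2 * M * norm v / 2 ^ (n + k)" for n k
    proof (induction k)
      case (Suc k)
      have "norm (s (n + Suc k) - s n) \<le> norm (s (n + k) - s n) + norm (h (R (n + k)))"
        using norm_triangle_ineq[of "s (n + k) - s n" "h (R (n + k))"]
        by (simp add: s_def algebra_simps)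
      moreover have "2 * M * norm v / 2 ^ (n + Suc k) = M * norm v / 2 ^ (n + k)"
        and "2 * M * norm v / 2 ^ (n + k) = 2 * (M * norm v / 2 ^ (n + k))" by simp_all
      ultimately show ?case using Suc step[of "n + k"] by linarith
    qed simp
    have dist': "norm (s m - s n) \<le> 2 * M * norm v / 2 ^ n" if "n \<le> m" for m n
    proof -
      have "0 \<le> 2 * M * norm v / 2 ^ m" using M by simp
      then show ?thesis using dist[of n "m - n"] that by simp
    qed
    have half: "(\<lambda>n. C / 2 ^ n) \<longlonglongrightarrow> 0" for C :: real
      using tendsto_mult_right_zero[OF LIMSEQ_power_zero[of "1/2::real"], of C]
      by (simp add: power_one_over field_simps)
    have "Cauchy s"
    proof (rule CauchyI')
      fix e :: real assume "0 < e"
      then obtain n where n: "2 * M * norm v / 2 ^ n < e"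
        using order_tendstoD(2)[OF half[of "2 * M * norm v"]] eventually_happens' sequentially_bot
        by blast
      have "dist (s m) (s k) < e" if "n \<le> m" "m < k" for m k
      proof -
        have "2 * M * norm v / 2 ^ m \<le> 2 * M * norm v / 2 ^ n"
          using that M by (intro divide_left_mono power_increasing) auto
        then show ?thesis
          using dist'[of m k] that n by (simp add: dist_norm norm_minus_commute)
      qed
      then show "\<exists>n. \<forall>m\<ge>n. \<forall>k>m. dist (s m) (s k) < e" by blast
    qed
    then obtain x where x: "s \<longlonglongrightarrow> x"
      by (meson Cauchy_convergent_iff convergent_def)
    have "R \<longlonglongrightarrow> 0"
      by (rule Lim_null_comparison[OF _ half[of "norm v"]]) (use R_norm in auto)
    then have "(\<lambda>n. v - R n) \<longlonglongrightarrow> v - 0" by (intro tendsto_intros)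
    moreover have "(\<lambda>n. v - R n) \<longlonglongrightarrow> A x"
      using A.tendsto[OF x] by (simp add: A_s)
    ultimately have "A x = v" using LIMSEQ_unique by fastforce
    moreover have "norm x \<le> 2 * M * norm v"
      using dist'[of 0] by (intro Lim_bounded[OF tendsto_norm[OF x], of 0]) (simp add: s_def)
    ultimately show ?thesis by blast
  qed
  then show ?thesis using that by blast
qed

section \<open>Riesz representation, projections and adjoints\<close>

text \<open>The representing vector is the minimiser over \<open>U\<close> of \<open>J x = \<parallel>x\<parallel>\<^sup>2 - 2 f x\<close>: the parallelogram law
  makes minimising sequences Cauchy, and the vanishing of the first variation of \<open>J\<close> at the
  minimiser \<open>u\<close> says that \<open>f x = \<langle>x, u\<rangle>\<close>. The functional is only required to be linear on \<open>U\<close>, as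
  is the case for \<open>v \<mapsto> \<langle>A\<^sup>-\<^sup>1 v, c\<rangle>\<close>.\<close>

lemma Riesz_closed_subspace:
  fixes f :: "'a::{real_inner, complete_space} \<Rightarrow> real"
  assumes U: "subspace U" "closed U"
    and add: "\<And>x y. x \<in> U \<Longrightarrow> y \<in> U \<Longrightarrow> f (x + y) = f x + f y"
    and scale: "\<And>t x. x \<in> U \<Longrightarrow> f (t *\<^sub>R x) = t * f x"
    and bound: "\<And>x. x \<in> U \<Longrightarrow> \<bar>f x\<bar> \<le> K * norm x"
  shows "\<exists>u\<in>U. \<forall>x\<in>U. f x = x \<bullet> u"
proof -
  define J where "J x = x \<bullet> x - 2 * f x" for x
  define d where "d = Inf (J ` U)"
  have "0 \<in> U" using U by (simp add: subspace_0)
  have "- K\<^sup>2 \<le> J x" if "x \<in> U" for x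
  proof -
    have "0 \<le> (norm x - K)\<^sup>2" by simp
    then show ?thesis
      using bound[OF that] by (simp add: J_def power2_norm_eq_inner[symmetric] power2_diff algebra_simps)
  qed
  then have bdd: "bdd_below (J ` U)" by (auto intro: bdd_belowI[of _ "- K\<^sup>2"])
  have d_le: "d \<le> J x" if "x \<in> U" for x
    unfolding d_def using bdd that by (simp add: cINF_lower)
  have "\<exists>x\<in>U. J x < d + e" if "0 < e" for e
    using cInf_lessD[of "J ` U" "d + e"] \<open>0 \<in> U\<close> that by (auto simp: d_def)
  then have "\<forall>n. \<exists>x\<in>U. J x < d + inverse (real (Suc n))" by simp
  then obtain s where s: "\<And>n. s n \<in> U" and J_s: "\<And>n. J (s n) < d + inverse (real (Suc n))"
    by metis
  \<comment> \<open>The parallelogram law, with \<open>d \<le> J\<close> applied at the midpoint.\<close>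
  have close: "(norm (x - y))\<^sup>2 \<le> 2 * (J x - d) + 2 * (J y - d)" if "x \<in> U" "y \<in> U" for x y
  proof -
    have "(1/2) *\<^sub>R (x + y) \<in> U" using that U by (simp add: subspace_add subspace_scale)
    then have "4 * d \<le> 4 * J ((1/2) *\<^sub>R (x + y))" using d_le by simp
    also have "\<dots> = (x + y) \<bullet> (x + y) - 4 * (f x + f y)"
    proof -
      have "f ((1/2) *\<^sub>R (x + y)) = (f x + f y) / 2"
        using that U by (simp only: scale add subspace_add)
      then show ?thesis by (simp add: J_def)
    qed
    finally show ?thesis
      by (simp add: J_def power2_norm_eq_inner inner_simps inner_commute algebra_simps)
  qed
  have "Cauchy s"
  proof (rule CauchyI')
    fix e :: real assume e: "0 < e"
    obtain n where n: "inverse (real (Suc n)) < e\<^sup>2 / 4"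
      using reals_Archimedean[of "e\<^sup>2 / 4"] e by auto
    have "dist (s m) (s k) < e" if "n \<le> m" "m < k" for m k
    proof -
      have J_less: "J (s j) - d < e\<^sup>2 / 4" if "n \<le> j" for j
      proof -
        have "J (s j) - d < inverse (real (Suc j))" using J_s[of j] by simp
        also have "\<dots> \<le> inverse (real (Suc n))" using that by (simp add: le_imp_inverse_le)
        also note n
        finally show ?thesis .
      qed
      have "(norm (s m - s k))\<^sup>2 \<le> 2 * (J (s m) - d) + 2 * (J (s k) - d)"
        by (intro close s)
      also have "\<dots> < e\<^sup>2"
        using J_less[of m] J_less[of k] that by simp
      finally have "(norm (s m - s k))\<^sup>2 < e\<^sup>2" .
      then show ?thesis using e by (simp add: dist_norm power2_less_imp_less)
    qed
    then show "\<exists>n. \<forall>m\<ge>n. \<forall>k>m. dist (s m) (s k) < e" by blast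
  qed
  then obtain u where u: "s \<longlonglongrightarrow> u"
    by (meson Cauchy_convergent_iff convergent_def)
  have "u \<in> U" using closed_sequentially[OF U(2)] s u by blast
  have "(\<lambda>n. f (s n)) \<longlonglongrightarrow> f u"
  proof (rule LIM_zero_cancel, rule Lim_null_comparison)
    have "f (s n) - f u = f (s n - u)" for n
      using add[of "s n" "(-1) *\<^sub>R u"] scale[of u "-1"] s \<open>u \<in> U\<close> U by (simp add: subspace_neg)
    then show "\<forall>\<^sub>F n in sequentially. norm (f (s n) - f u) \<le> K * norm (s n - u)"
      using bound s \<open>u \<in> U\<close> U by (simp add: subspace_diff)
    show "(\<lambda>n. K * norm (s n - u)) \<longlonglongrightarrow> 0"
      using tendsto_mult_right_zero[OF tendsto_norm_zero[OF LIM_zero[OF u]]] by blast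
  qed
  then have "(\<lambda>n. J (s n)) \<longlonglongrightarrow> J u"
    unfolding J_def using u by (intro tendsto_intros)
  moreover have "(\<lambda>n. d + inverse (real (Suc n))) \<longlonglongrightarrow> d"
    using tendsto_add[OF tendsto_const LIMSEQ_inverse_real_of_nat] by simp
  ultimately have J_u: "J u \<le> d"
    by (rule LIMSEQ_le) (use J_s less_imp_le in blast)
  have "f x = x \<bullet> u" if x: "x \<in> U" for x
  proof -
    define g where "g = u \<bullet> x - f x"
    \<comment> \<open>A parabola that vanishes at \<open>0\<close> and is nonnegative everywhere has slope \<open>0\<close> there.\<close>
    have quad: "0 \<le> 2 * t * g + t\<^sup>2 * (x \<bullet> x)" for t
    proof -
      have "u + t *\<^sub>R x \<in> U" using x \<open>u \<in> U\<close> U by (simp add: subspace_add subspace_scale)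
      then have "J u \<le> J (u + t *\<^sub>R x)" using d_le J_u by force
      also have "\<dots> = J u + 2 * t * g + t\<^sup>2 * (x \<bullet> x)"
        using x \<open>u \<in> U\<close> U
        by (simp add: J_def g_def add scale subspace_scale inner_simps inner_commute
              power2_eq_square algebra_simps)
      finally show ?thesis by simp
    qed
    have "g = 0"
    proof (cases "x \<bullet> x = 0")
      case True
      then show ?thesis using quad[of 1] quad[of "-1"] by simp
    next
      case False
      then have "0 < x \<bullet> x" by simp
      then show ?thesis
        using quad[of "- g / (x \<bullet> x)"] by (simp add: power2_eq_square field_simps)
           (metis not_square_less_zero mult_eq_0_iff linorder_neqE_linordered_idom not_less)
    qed
    then show ?thesis by (simp add: g_def inner_commute)
  qed
  with \<open>u \<in> U\<close> show ?thesis by blast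
qed

lemma orth_proj_eqI:
  assumes "subspace U" and "u \<in> U" and "x - u \<in> U\<^sup>\<bottom>"
  shows "orth_proj U x = u"
  unfolding orth_proj_def
proof (rule the_equality)
  fix u' assume u': "u' \<in> U \<and> x - u' \<in> U\<^sup>\<bottom>"
  then have "u - u' \<in> U" using assms u' by (simp add: subspace_diff)
  moreover have "u - u' \<in> U\<^sup>\<bottom>"
    using subspace_diff[OF subspace_orthogonal_comp, of "x - u'" U "x - u"] assms u' by simp
  ultimately have "u - u' \<in> {0}"
    unfolding orthogonal_Int_0[OF assms(1), symmetric] by (rule IntI)
  then show "u' = u" by simp
qed (use assms in auto)

lemma orth_proj_decomposition:
  fixes U :: "'a::{real_inner, complete_space} set"
  assumes "subspace U" and "closed U"
  shows "orth_proj U x \<in> U" and "x - orth_proj U x \<in> U\<^sup>\<bottom>"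
proof -
  have "\<exists>u\<in>U. \<forall>y\<in>U. x \<bullet> y = y \<bullet> u"
  proof (rule Riesz_closed_subspace[OF assms, of "\<lambda>y. x \<bullet> y" "norm x"])
    show "\<bar>x \<bullet> y\<bar> \<le> norm x * norm y" for y by (rule Cauchy_Schwarz_ineq2)
  qed (simp_all add: inner_add_right)
  then obtain u where u: "u \<in> U" "\<And>y. y \<in> U \<Longrightarrow> x \<bullet> y = y \<bullet> u" by blast
  have "y \<bullet> (x - u) = 0" if "y \<in> U" for y
    using u(2)[OF that] inner_commute[of x y] by (simp add: inner_diff_right)
  then have "x - u \<in> U\<^sup>\<bottom>"
    by (simp add: orthogonal_comp_def orthogonal_def)
  with u(1) have "orth_proj U x = u" using orth_proj_eqI[OF assms(1)] by blast
  then show "orth_proj U x \<in> U" and "x - orth_proj U x \<in> U\<^sup>\<bottom>"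
    using \<open>u \<in> U\<close> \<open>x - u \<in> U\<^sup>\<bottom>\<close> by auto
qed

lemma adjoint_on_eqI:
  assumes "subspace U" and "u \<in> U" and "\<And>v. v \<in> U \<Longrightarrow> T v \<bullet> c = v \<bullet> u"
  shows "adjoint_on U T c = u"
  unfolding adjoint_on_def
proof (rule the_equality)
  fix u' assume u': "u' \<in> U \<and> (\<forall>v\<in>U. T v \<bullet> c = v \<bullet> u')"
  then have "u' - u \<in> U" using assms by (simp add: subspace_diff)
  then have "(u' - u) \<bullet> (u' - u) = 0"
    using u' assms(3)[of "u' - u"] by (simp add: inner_diff_right)
  then show "u' = u" by simp
qed (use assms in auto)

text \<open>The operator \<open>inv A\<close> is bounded on \<open>range A\<close> by the open mapping theorem, so the Riesz
  representation applies and the vector described by \<^const>\<open>adjoint_on\<close> exists. The second claim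
  reads \<open>A\<^sup>* (A\<^sup>-\<^sup>1)\<^sup>* c = c\<close>; it is what makes the estimator unbiased.\<close>

lemma adjoint_on_inverse:
  fixes A :: "'g::{real_inner, complete_space} \<Rightarrow> 'h::{real_inner, complete_space}"
  assumes "bounded_linear A" and "inj A" and "closed (range A)"
  shows "adjoint_on (range A) (inv A) c \<in> range A"
    and "A b \<bullet> adjoint_on (range A) (inv A) c = b \<bullet> c"
proof -
  interpret A: bounded_linear A by fact
  have U: "subspace (range A)" by (simp add: A.linear_axioms linear_subspace_image)
  obtain K where K: "\<And>v. v \<in> range A \<Longrightarrow> \<exists>x. A x = v \<and> norm x \<le> K * norm v"
    using bounded_preimage[OF assms(1,3)] by blast
  have inv_A: "inv A (A x) = x" for x using assms(2) by simp
  have norm_le: "norm x \<le> K * norm (A x)" for x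
    using K[of "A x"] assms(2) by (auto dest: injD)
  have "\<exists>u\<in>range A. \<forall>v\<in>range A. inv A v \<bullet> c = v \<bullet> u"
  proof (rule Riesz_closed_subspace[OF U assms(3), of "\<lambda>v. inv A v \<bullet> c" "K * norm c"])
    fix x y t assume "x \<in> range A"
    then obtain a where a: "x = A a" by auto
    show "inv A (t *\<^sub>R x) \<bullet> c = t * (inv A x \<bullet> c)"
      by (simp add: a inv_A flip: A.scaleR)
    show "\<bar>inv A x \<bullet> c\<bar> \<le> K * norm c * norm x"
    proof -
      have "\<bar>a \<bullet> c\<bar> \<le> norm a * norm c" by (rule Cauchy_Schwarz_ineq2)
      also have "\<dots> \<le> K * norm x * norm c"
        unfolding a by (intro mult_right_mono norm_le) simp
      finally show ?thesis by (simp add: a inv_A mult_ac)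
    qed
    assume "y \<in> range A"
    then obtain b where "y = A b" by auto
    then show "inv A (x + y) \<bullet> c = inv A x \<bullet> c + inv A y \<bullet> c"
      by (simp add: a inv_A inner_add_left flip: A.add)
  qed
  then obtain u where u: "u \<in> range A" "\<And>v. v \<in> range A \<Longrightarrow> inv A v \<bullet> c = v \<bullet> u"
    by blast
  have "adjoint_on (range A) (inv A) c = u" by (rule adjoint_on_eqI[OF U u])
  then show "adjoint_on (range A) (inv A) c \<in> range A"
    and "A b \<bullet> adjoint_on (range A) (inv A) c = b \<bullet> c"
    using u(1) u(2)[of "A b"] by (simp_all add: inv_A)
qed

text \<open>The vector \<open>(A\<^sup>-\<^sup>1)\<^sup>* c\<close> lies in \<open>range A\<close> and hence does not see the component of \<open>y\<close> that
  the projection removes.\<close>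

lemma inner_least_square_estimator:
  fixes A :: "'g::{real_inner, complete_space} \<Rightarrow> 'h::{real_inner, complete_space}"
  assumes "bounded_linear A" and "inj A" and "closed (range A)"
  shows "c \<bullet> least_square_estimator A y = adjoint_on (range A) (inv A) c \<bullet> y"
proof -
  have U: "subspace (range A)"
    using assms(1) by (simp add: bounded_linear.linear linear_subspace_image)
  define w where "w = adjoint_on (range A) (inv A) c"
  note decomp = orth_proj_decomposition[OF U assms(3), of y]
  from decomp(1) obtain b where b: "orth_proj (range A) y = A b" by auto
  have "w \<bullet> (y - A b) = 0"
    using decomp(2) adjoint_on_inverse(1)[OF assms, of c]
    by (auto simp: orthogonal_comp_def orthogonal_def w_def b)
  then have "w \<bullet> y = A b \<bullet> w" by (simp add: inner_diff_right inner_commute)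
  also have "\<dots> = c \<bullet> b"
    using adjoint_on_inverse(2)[OF assms, of b c] by (simp add: w_def inner_commute)
  finally show ?thesis
    using assms(2) by (simp add: least_square_estimator_def b w_def)
qed

section \<open>Quantiles and symmetric intervals of normal laws\<close>

text \<open>The infimum that defines the quantile is attained because a distribution function is
  right-continuous and tends to \<open>0\<close> and \<open>1\<close>.\<close>

lemma le_cdf_quantile:
  assumes "real_distribution M" and "0 < a" and "a < 1"
  shows "a \<le> cdf M (quantile M a)"
proof -
  interpret cdf_distribution M
    using assms(1) by (simp add: cdf_distribution_def)
  show ?thesis
    unfolding quantile_def by (rule iffD2[OF pseudoinverse[OF assms(2,3)] order_refl])
qed

text \<open>By symmetry the half-lines \<open>{..z}\<close> and \<open>{-z..}\<close> have the same probability, and two events of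
  probability \<open>p\<close> intersect with probability at least \<open>2 p - 1\<close>.\<close>

lemma std_normal_symmetric_interval:
  "2 * cdf std_normal_distribution z - 1 \<le> measure std_normal_distribution {-z..z}"
proof -
  interpret N: prob_space std_normal_distribution
    by (rule prob_space_normal_density) simp
  have "distributed std_normal_distribution lborel (\<lambda>x. x) std_normal_density"
    by (simp add: distributed_def distr_id2)
  then have "distributed std_normal_distribution lborel (\<lambda>x. 0 + (-1) * x) (normal_density (0 + (-1) * 0) (\<bar>-1\<bar> * 1))"
    by (intro N.normal_density_affine) simp_all
  then have "distr std_normal_distribution lborel uminus = std_normal_distribution"
    by (simp add: distributed_def)
  then have "N.prob {..z} = measure (distr std_normal_distribution lborel uminus) {..z}" by simp
  also have "\<dots> = N.prob {-z..}"
  proof -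
    have "uminus -` {..z} = {-z..}" by auto
    then show ?thesis by (simp add: measure_distr)
  qed
  finally have sym: "N.prob {..z} = N.prob {-z..}" .
  have "N.prob ({..z} \<union> {-z..}) = N.prob {..z} + N.prob {-z..} - N.prob ({..z} \<inter> {-z..})"
    by (rule measure_Un3) (simp_all add: N.fmeasurable_eq_sets)
  moreover have "{..z} \<inter> {-z..} = {-z..z}" by auto
  moreover have "N.prob ({..z} \<union> {-z..}) \<le> 1" by simp
  ultimately show ?thesis using sym by (simp add: cdf_def)
qed

text \<open>Each of the two tails carries at most \<open>\<alpha>/2\<close>, which is why the quantile is taken at
  \<open>1 - \<alpha>/2\<close>.\<close>

lemma normal_law_quantile_interval:
  assumes "0 < v" and "0 < \<alpha>" and "\<alpha> < 1"
  defines "r \<equiv> quantile std_normal_distribution (1 - \<alpha> / 2) * sqrt v"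
  shows "1 - \<alpha> \<le> measure (normal_law m v) {m - r .. m + r}"
proof -
  define z where "z = quantile std_normal_distribution (1 - \<alpha> / 2)"
  have r: "r = z * sqrt v" by (simp add: r_def z_def)
  define M where "M = normal_law m v"
  have M: "M = density lborel (normal_density m (sqrt v))"
    using assms by (simp add: M_def normal_law_def)
  interpret prob_space M unfolding M using assms by (intro prob_space_normal_density) simp
  have "distributed M lborel (\<lambda>x. x) (normal_density m (sqrt v))"
    by (simp add: distributed_def distr_id2 M)
  then have "distributed M lborel (\<lambda>x. (x - m) / sqrt v) std_normal_density"
    using normal_standard_normal_convert[of "sqrt v"] assms by simp
  then have D: "distr M lborel (\<lambda>x. (x - m) / sqrt v) = std_normal_distribution"
    by (simp add: distributed_def)
  have "1 - \<alpha> \<le> 2 * cdf std_normal_distribution z - 1"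
    using le_cdf_quantile[OF real_dist_normal_dist, of "1 - \<alpha> / 2"] assms by (simp add: z_def)
  also have "\<dots> \<le> measure std_normal_distribution {-z..z}"
    by (rule std_normal_symmetric_interval)
  also have "\<dots> = measure M ((\<lambda>x. (x - m) / sqrt v) -` {-z..z} \<inter> space M)"
    unfolding D[symmetric] by (subst measure_distr) (simp_all add: M)
  also have "(\<lambda>x. (x - m) / sqrt v) -` {-z..z} \<inter> space M = {m - r .. m + r}"
    using assms(1) by (auto simp: M r field_simps)
  finally show ?thesis by (simp add: M_def)
qed

section \<open>The confidence interval\<close>

theorem corollary10p3:
  fixes Q :: "'h::{real_inner, polish_space} \<Rightarrow> 'h"
    and A :: "'g::{real_inner, polish_space} \<Rightarrow> 'h"
    and P :: "'g \<Rightarrow> 'h measure"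
    and \<sigma> \<alpha> :: real
    and c :: 'g
  defines "U \<equiv> range A"
  defines "w \<equiv> adjoint_on U (inv A) c"
  assumes "bounded_linear Q"
    and "\<And>x y. Q x \<bullet> y = x \<bullet> Q y"
    and "\<And>x. 0 \<le> Q x \<bullet> x"
    and "nuclear_operator Q"
    and "bounded_linear A" and "inj A"
    and "closed U"
    and "Q ` U \<subseteq> U" and "Q ` (U\<^sup>\<bottom>) \<subseteq> U\<^sup>\<bottom>"
    and "0 < \<sigma>"
    and "\<And>\<beta>. gaussian_measure (P \<beta>) (A \<beta>) (\<lambda>x. \<sigma>\<^sup>2 *\<^sub>R Q x)"
    and "0 < Q w \<bullet> orth_proj U w"
    and "0 < \<alpha>" and "\<alpha> < 1"
  shows "confidence_interval P (\<lambda>\<beta>. c \<bullet> \<beta>)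
     (\<lambda>y. let m = c \<bullet> least_square_estimator A y;
              r = quantile std_normal_distribution (1 - \<alpha> / 2) * \<sigma> * sqrt (Q w \<bullet> orth_proj U w)
          in {m - r .. m + r})
     (1 - \<alpha>)"
proof -
  have subspace: "subspace U"
    unfolding U_def using \<open>bounded_linear A\<close> by (simp add: bounded_linear.linear linear_subspace_image)
  note A = \<open>bounded_linear A\<close> \<open>inj A\<close> \<open>closed U\<close>[unfolded U_def]
  have w: "w \<in> U" "A \<beta> \<bullet> w = c \<bullet> \<beta>" for \<beta>
    using adjoint_on_inverse[OF A, where c = c] by (simp_all add: w_def U_def inner_commute[of c])
  have proj_w: "orth_proj U w = w"
    using subspace w by (intro orth_proj_eqI) (auto simp: subspace_0 subspace_orthogonal_comp)
  have estimate: "c \<bullet> least_square_estimator A y = w \<bullet> y" for y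
    unfolding w_def U_def by (rule inner_least_square_estimator[OF A])
  define v where "v = \<sigma>\<^sup>2 * (Q w \<bullet> w)"
  define r where "r = quantile std_normal_distribution (1 - \<alpha> / 2) * sqrt v"
  have "0 < v" using assms proj_w by (simp add: v_def)
  have r: "quantile std_normal_distribution (1 - \<alpha> / 2) * \<sigma> * sqrt (Q w \<bullet> orth_proj U w) = r"
    using \<open>0 < \<sigma>\<close> by (simp add: r_def v_def proj_w real_sqrt_mult)
  have "{y \<in> space (P \<beta>). c \<bullet> \<beta> \<in> {w \<bullet> y - r .. w \<bullet> y + r}} \<in> sets (P \<beta>) \<and>
        1 - \<alpha> \<le> measure (P \<beta>) {y \<in> space (P \<beta>). c \<bullet> \<beta> \<in> {w \<bullet> y - r .. w \<bullet> y + r}}" for \<beta>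
  proof -
    have sets: "sets (P \<beta>) = sets borel"
      and law: "distr (P \<beta>) borel (\<lambda>y. w \<bullet> y) = normal_law (c \<bullet> \<beta>) v"
      using \<open>gaussian_measure (P \<beta>) (A \<beta>) (\<lambda>x. \<sigma>\<^sup>2 *\<^sub>R Q x)\<close> w(2)[of \<beta>]
      by (auto simp: gaussian_measure_def v_def inner_commute[of w "A \<beta>"])
    have meas: "(\<lambda>y. w \<bullet> y) \<in> borel_measurable (P \<beta>)"
      unfolding measurable_cong_sets[OF sets refl] by simp
    \<comment> \<open>The random interval around \<open>w \<bullet> y\<close> covers \<open>c \<bullet> \<beta>\<close> exactly when \<open>w \<bullet> y\<close> falls into the fixed
      interval around \<open>c \<bullet> \<beta>\<close>.\<close>
    have event: "{y \<in> space (P \<beta>). c \<bullet> \<beta> \<in> {w \<bullet> y - r .. w \<bullet> y + r}} =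
        (\<lambda>y. w \<bullet> y) -` {c \<bullet> \<beta> - r .. c \<bullet> \<beta> + r} \<inter> space (P \<beta>)"
      by auto
    have "1 - \<alpha> \<le> measure (normal_law (c \<bullet> \<beta>) v) {c \<bullet> \<beta> - r .. c \<bullet> \<beta> + r}"
      unfolding r_def using \<open>0 < v\<close> \<open>0 < \<alpha>\<close> \<open>\<alpha> < 1\<close> by (rule normal_law_quantile_interval)
    then show ?thesis
      unfolding event law[symmetric] using meas by (simp add: measure_distr measurable_sets)
  qed
  then show ?thesis
    by (simp add: confidence_interval_def Let_def estimate r)
qed

end
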